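(* Let $\nu,\mu,\eta\in\mathcal V$ be such that $\nu<\mu\le\eta$, and let $\overline\mu\in\overline{\mathcal V}$ be an extension of $\mu$ to $\overline K[x]$. Then there exist extensions $\overline\nu\in\overline{\mathcal V}$ of $\nu$ and $\overline\eta\in\overline{\mathcal V}$ of $\eta$ such that $\overline\nu<\overline\mu\le\overline\eta$.
   Context: $(K,v)$ is a valued field, $\overline K$ an algebraic closure of $K$, and $v$ also denotes a fixed extension of $v$ to $\overline K$. Put $\Gamma=v\overline K$ (the value group of $\overline K$) and fix an embedding $\Gamma\hookrightarrow\Lambda$ into a divisible (totally) ordered abelian group $\Lambda$. $\mathcal V$ is the set of all $\Lambda$-valued valuations on $K(x)$ whose restriction to $K$ is $v$, identified with valuations $\mu:K[x]\to\Lambda\cup\{\infty\}$ with $\mu^{-1}(\infty)=\{0\}$ and $\mu_{\mid K}=v$. $\overline{\mathcal V}$ is the set of all $\Lambda$-valued valuations on $\overline K(x)$ whose restriction to $\overline K$ is $v$. Both sets are partially ordered by $\mu\le\eta$ iff $\mu(f)\le\eta(f)$ for all polynomials $f$; $\mu<\eta$ means $\mu\le\eta$ and $\mu\ne\eta$. An extension of $\mu\in\mathcal V$ is an element $\overline\mu\in\overline{\mathcal V}$ with $\overline\mu_{\mid K[x]}=\mu$. *)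

theory Defs
  imports "HOL-Computational_Algebra.Polynomial" "HOL-Library.Extended"
begin

text \<open>\<open>\<Lambda> \<union> {\<infinity>}\<close> is rendered by the library type \<^typ>\<open>'g extended\<close> with
  \<open>\<infinity> = Pinf\<close>; the superfluous element \<^term>\<open>Minf\<close> of that type is excluded as a value.\<close>

definition is_valuation :: "('a::idom \<Rightarrow> 'g::linordered_ab_group_add extended) \<Rightarrow> bool" where
  "is_valuation w \<longleftrightarrow>
     (\<forall>f. w f \<noteq> Minf) \<and>
     (\<forall>f. w f = Pinf \<longleftrightarrow> f = 0) \<and>
     w 1 = 0 \<and>
     (\<forall>f g. w (f * g) = w f + w g) \<and>
     (\<forall>f g. w (f + g) \<ge> min (w f) (w g))"

text \<open>Valuations on the rational function field over \<open>'a\<close> extending \<open>v\<close>, identified with their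
  restrictions to the polynomial ring. The partial order on them is the library's pointwise
  order on functions.\<close>

definition poly_valuations ::
    "('a::field \<Rightarrow> 'g::linordered_ab_group_add extended) \<Rightarrow> ('a poly \<Rightarrow> 'g extended) set" where
  "poly_valuations v = {\<mu>. is_valuation \<mu> \<and> (\<forall>a. \<mu> [:a:] = v a)}"

definition is_divisible_group :: "'g::ab_group_add itself \<Rightarrow> bool" where
  "is_divisible_group _ \<longleftrightarrow> (\<forall>n::nat. n > 0 \<longrightarrow> (\<forall>a::'g. \<exists>b. (\<Sum>i<n. b) = a))"

text \<open>The target is algebraically closed by its type class; it remains to say that
  \<open>\<iota>\<close> embeds the field and that every element of the target is algebraic over the image.\<close>

definition is_algebraic_closure :: "('k::field \<Rightarrow> 'l::alg_closed_field) \<Rightarrow> bool" where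
  "is_algebraic_closure \<iota> \<longleftrightarrow>
     \<iota> 1 = 1 \<and>
     (\<forall>a b. \<iota> (a + b) = \<iota> a + \<iota> b) \<and>
     (\<forall>a b. \<iota> (a * b) = \<iota> a * \<iota> b) \<and>
     (\<forall>y. \<exists>p. p \<noteq> 0 \<and> poly (map_poly \<iota> p) y = 0)"

definition extends_valuation ::
    "('k::field \<Rightarrow> 'l::field) \<Rightarrow> ('l poly \<Rightarrow> 'g extended) \<Rightarrow> ('k poly \<Rightarrow> 'g extended) \<Rightarrow> bool" where
  "extends_valuation \<iota> \<mu>' \<mu> \<longleftrightarrow> (\<forall>f. \<mu>' (map_poly \<iota> f) = \<mu> f)"

end

theory Submission
  imports Defs
begin

text \<open>
  For \<open>a \<in> L = \<close> algebraic closure of \<open>K\<close> and \<open>d \<in> \<Lambda>\<close> let \<open>\<omega>(a, d)\<close> be the valuation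
  \<open>\<Sum> c\<^sub>i (x - a)^i \<mapsto> min (v' c\<^sub>i + i d)\<close> on \<open>L[x]\<close>.

  Below: let \<open>\<phi>\<close> have minimal degree with \<open>\<nu>(\<phi>) < \<mu>(\<phi>)\<close>, and let \<open>a\<close> be a root of \<open>\<phi>\<close>
  with \<open>\<mu>'(x - a)\<close> maximal. As \<open>\<Lambda>\<close> is divisible, some \<open>d\<close> gives \<open>\<omega>(a, d)(\<phi>) = \<nu>(\<phi>)\<close>; then
  \<open>\<omega>(a, d) \<le> \<mu>'\<close>, and its restriction to \<open>K[x]\<close> is \<open>\<nu>\<close>, since both lie below \<open>\<mu>\<close> and agree at \<open>\<phi>\<close>.

  Above: by Zorn's lemma take \<open>\<xi> \<ge> \<mu>'\<close> maximal among the valuations whose restriction to \<open>K[x]\<close>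
  is at most \<open>\<eta>\<close>. If \<open>\<xi>(\<phi>) < \<eta>(\<phi>)\<close> for some \<open>\<phi>\<close>, of minimal degree, then \<open>\<xi> = \<omega>(a, g)\<close> for a
  root \<open>a\<close> of \<open>\<phi>\<close>, and raising \<open>g\<close> to the \<open>d\<close> with \<open>\<omega>(a, d)(\<phi>) = \<eta>(\<phi>)\<close> contradicts maximality.
\<close>

subsection \<open>Arithmetic of extended values\<close>

lemma extended_cancel_le:
  fixes a b c :: "'g::linordered_ab_group_add extended"
  assumes "c \<noteq> Pinf" "c \<noteq> Minf"
  shows "c + a \<le> c + b \<longleftrightarrow> a \<le> b"
  using assms by (cases a; cases b; cases c) auto

lemma extended_cancel_less:
  fixes a b c :: "'g::linordered_ab_group_add extended"
  assumes "c \<noteq> Pinf" "c \<noteq> Minf"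
  shows "c + a < c + b \<longleftrightarrow> a < b"
  using assms by (cases a; cases b; cases c) auto

lemma extended_add_less_le_mono:
  fixes a b c d :: "'g::linordered_ab_group_add extended"
  assumes "a < b" "c \<le> d" "c \<noteq> Pinf" "c \<noteq> Minf"
  shows "a + c < b + d"
  using assms by (cases a; cases b; cases c; cases d) (auto intro: add_less_le_mono)

lemma extended_add_eq_Pinf_iff:
  fixes a b :: "'g::linordered_ab_group_add extended"
  shows "a + b = Pinf \<longleftrightarrow> a = Pinf \<or> b = Pinf"
  by (cases a; cases b) auto

lemma extended_add_Pinf:
  fixes a :: "'g::linordered_ab_group_add extended"
  shows "a + Pinf = Pinf"
  by (cases a) auto

subsection \<open>Valuations\<close>

context
  fixes w :: "'a::idom \<Rightarrow> 'g::linordered_ab_group_add extended"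
  assumes w: "is_valuation w"
begin

lemma val_not_Minf [simp]: "w f \<noteq> Minf"
  using w by (auto simp: is_valuation_def)

lemma val_eq_Pinf_iff: "w f = Pinf \<longleftrightarrow> f = 0"
  using w by (auto simp: is_valuation_def)

lemma val_0: "w 0 = Pinf"
  by (simp add: val_eq_Pinf_iff)

lemma val_1: "w 1 = 0"
  using w by (auto simp: is_valuation_def)

lemma val_mult: "w (f * g) = w f + w g"
  using w by (auto simp: is_valuation_def)

lemma val_add: "min (w f) (w g) \<le> w (f + g)"
  using w by (auto simp: is_valuation_def)

lemma val_uminus: "w (- f) = w f"
proof -
  have "w (-1) + w (-1) = 0"
    using val_mult[of "-1" "-1"] val_1 by simp
  hence "w (-1) = 0"
    by (cases "w (-1)") (auto simp: zero_extended_def)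
  thus ?thesis
    using val_mult[of "-1" f] by simp
qed

lemma val_diff: "min (w f) (w g) \<le> w (f - g)"
  using val_add[of f "- g"] by (simp add: val_uminus)

lemma val_add_eq_left:
  assumes "w f < w g"
  shows "w (f + g) = w f"
proof (rule antisym)
  show "w f \<le> w (f + g)"
    using val_add[of f g] assms by (auto simp: min_def split: if_splits)
  have "min (w (f + g)) (w g) \<le> w f"
    using val_diff[of "f + g" g] by simp
  thus "w (f + g) \<le> w f"
    using assms by (auto simp: min_def split: if_splits)
qed

lemma val_add_eq_right: "w g < w f \<Longrightarrow> w (f + g) = w g"
  using val_add_eq_left[of g f] by (simp add: add.commute)

lemma val_add_eq_min_of_neq: "w f \<noteq> w g \<Longrightarrow> w (f + g) = min (w f) (w g)"
  using val_add_eq_left[of f g] val_add_eq_right[of g f]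
  by (cases "w f" "w g" rule: linorder_cases) auto

end

text \<open>If the smaller of two valuations jumps on one summand and not on the other, cancellation
  between the summands would be visible to the larger valuation.\<close>

lemma val_add_eq_min:
  assumes "is_valuation \<rho>" "is_valuation \<eta>" "\<And>f. \<rho> f \<le> \<eta> f"
    and "f = 0 \<or> \<rho> f < \<eta> f" "\<rho> g = \<eta> g"
  shows "\<rho> (f + g) = min (\<rho> f) (\<rho> g)"
proof (cases "\<rho> f = \<rho> g \<and> f \<noteq> 0")
  case True
  hence "\<eta> (g + f) = \<eta> g"
    using assms by (intro val_add_eq_left) auto
  hence "\<rho> (f + g) \<le> \<rho> g"
    using assms(3)[of "f + g"] assms(5) by (simp add: add.commute)
  thus ?thesis
    using val_add[OF assms(1), of f g] True by auto
next
  case False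
  thus ?thesis
    using val_add_eq_left[OF assms(1), of f g] val_add_eq_right[OF assms(1), of g f]
      val_0[OF assms(1)]
    by (cases "\<rho> f" "\<rho> g" rule: linorder_cases) (auto simp: min_def)
qed

lemma val_mult_strict_mono:
  assumes "is_valuation \<rho>" "is_valuation \<eta>" "\<And>f. \<rho> f \<le> \<eta> f"
    and "\<rho> f < \<eta> f" "h \<noteq> 0"
  shows "\<rho> (f * h) < \<eta> (f * h)"
  using assms by (simp add: val_mult extended_add_less_le_mono val_eq_Pinf_iff)

text \<open>The disjunction has the shape of the fourth hypothesis of \<open>val_add_eq_min\<close>,
  so that every multiple of a jumping polynomial, zero included, can be fed to it.\<close>

lemma val_mult_less_iff:
  assumes "is_valuation \<rho>" "is_valuation \<eta>" "\<And>f. \<rho> f \<le> \<eta> f"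
    and "\<rho> f < \<eta> f"
  shows "f * h = 0 \<or> \<rho> (f * h) < \<eta> (f * h)"
  using val_mult_strict_mono[OF assms] by (cases "h = 0") auto

subsection \<open>Gauss valuations\<close>

text \<open>Horner form of the minimum of \<open>v c + i d\<close> over the coefficients
  \<open>c\<close> at \<open>x^i\<close>, suited to induction along \<open>pCons\<close>;
  \<open>Fin d\<close> is the value given to the variable.\<close>

definition gauss ::
    "('a::idom \<Rightarrow> 'g::linordered_ab_group_add extended) \<Rightarrow> 'g \<Rightarrow> 'a poly \<Rightarrow> 'g extended" where
  "gauss v d p = fold_coeffs (\<lambda>c r. min (v c) (Fin d + r)) p Pinf"

context
  fixes v :: "'a::idom \<Rightarrow> 'g::linordered_ab_group_add extended" and d :: 'g
  assumes v: "is_valuation v"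
begin

lemma gauss_0 [simp]: "gauss v d 0 = Pinf"
  by (simp add: gauss_def)

lemma gauss_pCons: "gauss v d (pCons c p) = min (v c) (Fin d + gauss v d p)"
proof (cases "c = 0 \<and> p = 0")
  case True
  thus ?thesis by (simp add: val_0[OF v])
next
  case False
  thus ?thesis by (cases "c = 0") (auto simp: gauss_def)
qed

lemma gauss_const: "gauss v d [:c:] = v c"
  by (simp add: gauss_pCons)

lemma gauss_le_coeff_0: "gauss v d p \<le> v (coeff p 0)"
  by (cases p) (simp add: gauss_pCons)

lemma gauss_not_Minf: "gauss v d p \<noteq> Minf"
proof (induction p)
  case (pCons c p)
  thus ?case
    using val_not_Minf[OF v, of c] by (cases "gauss v d p") (auto simp: gauss_pCons min_def)
qed simp

lemma gauss_eq_Pinf_iff: "gauss v d p = Pinf \<longleftrightarrow> p = 0"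
proof (induction p)
  case (pCons c p)
  thus ?case
    using val_eq_Pinf_iff[OF v, of c]
    by (auto simp: gauss_pCons min_def extended_add_eq_Pinf_iff split: if_splits)
qed simp

lemma gauss_add: "min (gauss v d p) (gauss v d q) \<le> gauss v d (p + q)"
proof (induction p q rule: poly_induct2)
  case (pCons a p b q)
  have "min (v a) (v b) \<le> v (a + b)"
    by (rule val_add[OF v])
  moreover have "min (Fin d + gauss v d p) (Fin d + gauss v d q) \<le> Fin d + gauss v d (p + q)"
    using pCons by (auto simp: min_def extended_cancel_le split: if_splits)
  ultimately show ?case
    using min.mono by (fastforce simp add: gauss_pCons min.assoc min.left_commute)
qed simp

lemma gauss_smult: "gauss v d (smult c p) = v c + gauss v d p"
proof (induction p)
  case (pCons a p)
  have "v c + min (v a) (Fin d + gauss v d p) = min (v c + v a) (v c + (Fin d + gauss v d p))"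
    by (simp add: min_def antisym add_left_mono)
  thus ?case
    using pCons by (simp add: gauss_pCons val_mult[OF v] add.left_commute)
qed (simp add: extended_add_Pinf)

lemma gauss_mult_ge: "gauss v d p + gauss v d q \<le> gauss v d (p * q)"
proof (induction p)
  case (pCons c p)
  have *: "gauss v d (pCons 0 (p * q)) = Fin d + gauss v d (p * q)"
    by (simp add: gauss_pCons val_0[OF v])
  have "gauss v d (pCons c p) + gauss v d q \<le> min (v c + gauss v d q) (Fin d + gauss v d p + gauss v d q)"
    by (simp add: gauss_pCons add_right_mono)
  also have "\<dots> \<le> min (gauss v d (smult c q)) (gauss v d (pCons 0 (p * q)))"
    using pCons by (simp add: gauss_smult * add.assoc add_left_mono min.coboundedI2)
  also have "\<dots> \<le> gauss v d (pCons c p * q)"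
    using gauss_add[of "smult c q" "pCons 0 (p * q)"] by simp
  finally show ?case .
qed (simp add: extended_add_eq_Pinf_iff)

text \<open>Gauss's lemma by peeling off constant terms. If the constant term of one factor lies
  above the minimum, subtracting its multiple of the other factor from the product leaves
  \<open>x\<close> times a smaller product, to which induction applies. If both constant terms
  attain the minimum, the constant coefficient of the product gives the bound.\<close>

lemma gauss_mult_le: "gauss v d (p * q) \<le> gauss v d p + gauss v d q"
proof (induction p arbitrary: q)
  case 0
  show ?case by (cases "gauss v d q") auto
next
  case (pCons c p)
  let ?G = "gauss v d"
  note IH = pCons.IH
  have nz: "pCons c p \<noteq> 0"
    using pCons.hyps by simp
  have step: "?G (pCons c p * q) \<le> ?G (pCons c p) + ?G q"
    if "?G (pCons c p) < v c" and "q \<noteq> 0" for q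
  proof (rule ccontr)
    assume "\<not> ?thesis"
    moreover have eq: "?G (pCons c p) = Fin d + ?G p"
      using that(1) by (auto simp: gauss_pCons min_def split: if_splits)
    moreover have "pCons c p * q + smult (- c) q = pCons 0 (p * q)"
      by simp
    hence "Fin d + ?G (p * q) = ?G (pCons c p * q + smult (- c) q)"
      by (simp only: gauss_pCons val_0[OF v]) simp
    moreover have "min (?G (pCons c p * q)) (v c + ?G q) \<le> ?G (pCons c p * q + smult (- c) q)"
      using gauss_add[of "pCons c p * q" "smult (- c) q"] by (simp only: gauss_smult val_uminus[OF v])
    moreover have "?G (pCons c p) + ?G q < v c + ?G q"
      using that gauss_not_Minf gauss_eq_Pinf_iff by (intro extended_add_less_le_mono) auto
    ultimately have "Fin d + ?G p + ?G q < Fin d + ?G (p * q)"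
      by (auto simp: min_def split: if_splits)
    with IH[of q] show False
      by (simp add: add.assoc extended_cancel_less)
  qed
  show ?case
  proof (cases "?G (pCons c p) < v c")
    case True
    thus ?thesis using step by (cases "q = 0") (auto simp: extended_add_eq_Pinf_iff)
  next
    case False
    hence c: "?G (pCons c p) = v c"
      using gauss_le_coeff_0[of "pCons c p"] by simp
    show ?thesis
    proof (induction q)
      case (pCons e q)
      show ?case
      proof (cases "?G (pCons e q) < v e")
        case True
        hence eq: "?G (pCons e q) = Fin d + ?G q"
          by (auto simp: gauss_pCons min_def split: if_splits)
        let ?r = "smult (- e) (pCons c p)"
        have cne: "v c \<noteq> Pinf"
          using nz c gauss_eq_Pinf_iff by metis
        have "pCons c p * pCons e q + ?r = pCons 0 (pCons c p * q)"
          by (simp only: mult_pCons_right smult_minus_left) simp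
        hence "Fin d + ?G (pCons c p * q) = ?G (pCons c p * pCons e q + ?r)"
          by (simp only: gauss_pCons val_0[OF v]) simp
        moreover have "min (?G (pCons c p * pCons e q)) (v e + v c) \<le> ?G (pCons c p * pCons e q + ?r)"
          using gauss_add[of "pCons c p * pCons e q" ?r] by (simp only: gauss_smult val_uminus[OF v] c)
        moreover have "v c + ?G (pCons e q) < v e + v c"
          using True cne val_not_Minf[OF v] by (simp add: add.commute extended_cancel_less)
        moreover have "Fin d + ?G (pCons c p * q) \<le> v c + ?G (pCons e q)"
          using pCons.IH eq c by (simp add: add.left_commute add_left_mono)
        ultimately show ?thesis
          by (auto simp: min_def c split: if_splits)
      next
        case False
        hence "?G (pCons e q) = v e"
          using gauss_le_coeff_0[of "pCons e q"] by simp
        thus ?thesis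
          using gauss_le_coeff_0[of "pCons c p * pCons e q"] by (simp add: c coeff_mult val_mult[OF v] add.commute)
      qed
    qed (simp add: extended_add_eq_Pinf_iff)
  qed
qed

lemma is_valuation_gauss: "is_valuation (gauss v d)"
  using gauss_not_Minf gauss_eq_Pinf_iff gauss_const[of 1] gauss_mult_le gauss_mult_ge gauss_add
  by (auto simp: is_valuation_def val_1[OF v] one_pCons intro: antisym)

end

section \<open>Dependence of Gauss valuations on the value of the variable\<close>

lemma gauss_mono:
  assumes "is_valuation v" "d \<le> e"
  shows "gauss v d p \<le> gauss v e p"
proof (induction p)
  case (pCons c p)
  have "Fin d + gauss v d p \<le> Fin e + gauss v e p"
    using pCons assms(2) by (intro add_mono) auto
  thus ?case
    using assms(1) by (simp add: gauss_pCons min.coboundedI2)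
qed (simp add: assms)

text \<open>With \<open>gauss_attained\<close> this recovers the closed form of \<open>gauss\<close>
  as a minimum over monomials. The multiple \<open>i d\<close> is a sum over \<open>j<i\<close> to
  match \<open>is_divisible_group\<close>.\<close>

lemma gauss_le_coeff:
  assumes "is_valuation v"
  shows "gauss v d p \<le> v (coeff p i) + Fin (\<Sum>j<i. d)"
proof (induction p arbitrary: i)
  case 0
  show ?case by (simp add: val_0 assms)
next
  case (pCons c p)
  show ?case
  proof (cases i)
    case 0
    thus ?thesis by (simp add: gauss_pCons assms flip: zero_extended_def)
  next
    case (Suc k)
    have "Fin d + gauss v d p \<le> Fin d + (v (coeff p k) + Fin (\<Sum>j<k. d))"
      using pCons by (intro add_left_mono)
    also have "\<dots> = v (coeff p k) + Fin (\<Sum>j<i. d)"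
      by (simp add: Suc add.left_commute[of "Fin d"]) (simp add: add.commute)
    finally show ?thesis
      by (simp add: Suc gauss_pCons assms min.coboundedI2)
  qed
qed

lemma gauss_attained:
  assumes "is_valuation v" "p \<noteq> 0"
  shows "\<exists>i. coeff p i \<noteq> 0 \<and> gauss v d p = v (coeff p i) + Fin (\<Sum>j<i. d)"
  using assms(2)
proof (induction p)
  case (pCons c p)
  show ?case
  proof (cases "v c \<le> Fin d + gauss v d p")
    case True
    hence eq: "gauss v d (pCons c p) = v c"
      by (simp add: gauss_pCons assms)
    have "c \<noteq> 0"
      using eq gauss_eq_Pinf_iff[OF assms(1), of d "pCons c p"] pCons.hyps val_0[OF assms(1)] by auto
    thus ?thesis
      by (intro exI[of _ 0]) (simp add: eq flip: zero_extended_def)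
  next
    case False
    hence eq: "gauss v d (pCons c p) = Fin d + gauss v d p"
      by (simp add: gauss_pCons assms)
    have "p \<noteq> 0"
      using False by (auto simp: assms)
    then obtain i where "coeff p i \<noteq> 0" "gauss v d p = v (coeff p i) + Fin (\<Sum>j<i. d)"
      using pCons by auto
    thus ?thesis
      by (intro exI[of _ "Suc i"]) (simp add: eq add.left_commute[of "Fin d"], simp add: add.commute)
  qed
qed simp

text \<open>Each monomial separately can be given the value \<open>t\<close> by dividing in
  \<Lambda>; the exponent must be positive, hence the vanishing constant coefficient.\<close>

lemma gauss_prescribe:
  fixes v :: "'a::idom \<Rightarrow> 'g::linordered_ab_group_add extended"
  assumes v: "is_valuation v" and div: "is_divisible_group TYPE('g)"
    and p: "p \<noteq> 0" "coeff p 0 = 0"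
  obtains d where "gauss v d p = Fin t"
proof -
  define S where "S = {i. coeff p i \<noteq> 0}"
  have fin: "finite S"
    using MOST_coeff_eq_0[of p] by (simp add: S_def eventually_cofinite)
  have ne: "S \<noteq> {}"
    using p(1) by (auto simp: S_def poly_eq_iff)
  have "\<exists>d. v (coeff p i) + Fin (\<Sum>j<i. d) = Fin t" if i: "i \<in> S" for i
  proof -
    have "i > 0"
      using i p(2) by (cases i) (auto simp: S_def)
    moreover obtain c where c: "v (coeff p i) = Fin c"
      using i val_eq_Pinf_iff[OF v, of "coeff p i"] val_not_Minf[OF v, of "coeff p i"]
      by (cases "v (coeff p i)") (auto simp: S_def)
    ultimately obtain d where "(\<Sum>j<i. d) = t - c"
      using div by (auto simp: is_divisible_group_def)
    thus ?thesis
      by (intro exI[of _ d]) (simp add: c)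
  qed
  then obtain D where D: "\<And>i. i \<in> S \<Longrightarrow> v (coeff p i) + Fin (\<Sum>j<i. D i) = Fin t"
    by metis
  \<comment> \<open>The largest candidate lifts every monomial to at least \<open>t\<close> and
    leaves the one at \<open>k\<close> at exactly \<open>t\<close>.\<close>
  define d where "d = Max (D ` S)"
  have "d \<in> D ` S"
    unfolding d_def using fin ne by (intro Max_in) auto
  then obtain k where k: "k \<in> S" "d = D k"
    by blast
  obtain i where i: "i \<in> S" "gauss v d p = v (coeff p i) + Fin (\<Sum>j<i. d)"
    using gauss_attained[OF v p(1), of d] by (auto simp: S_def)
  have "D i \<le> d"
    using fin i(1) by (simp add: d_def)
  hence "v (coeff p i) + Fin (\<Sum>j<i. D i) \<le> gauss v d p"
    unfolding i(2) by (intro add_left_mono) (simp add: sum_mono)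
  moreover have "gauss v d p \<le> Fin t"
    using gauss_le_coeff[OF v, of d p k] D[OF k(1)] k(2) by simp
  ultimately have "gauss v d p = Fin t"
    using D[OF i(1)] by simp
  thus thesis by (rule that)
qed

text \<open>This is \<omega>(a, d): substituting \<open>x + a\<close> for \<open>x\<close> turns the
  expansion in powers of \<open>x - a\<close> into the coefficients that \<open>gauss\<close>
  reads.\<close>

definition centered ::
    "('a::field \<Rightarrow> 'g::linordered_ab_group_add extended) \<Rightarrow> 'a \<Rightarrow> 'g \<Rightarrow> 'a poly \<Rightarrow> 'g extended" where
  "centered v a d f = gauss v d (pcompose f [:a, 1:])"

context
  fixes v :: "'a::field \<Rightarrow> 'g::linordered_ab_group_add extended"
  assumes v: "is_valuation v"
begin

lemma pcompose_shift_eq_0_iff: "pcompose f [:a, 1:] = 0 \<longleftrightarrow> f = (0 :: 'a poly)"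
  by (simp add: pcompose_eq_0_iff)

lemma centered_poly_valuations: "centered v a d \<in> poly_valuations v"
  unfolding poly_valuations_def is_valuation_def centered_def
  by (auto simp: pcompose_mult pcompose_add pcompose_shift_eq_0_iff gauss_const[OF v]
    val_not_Minf[OF is_valuation_gauss[OF v]] val_eq_Pinf_iff[OF is_valuation_gauss[OF v]]
    val_mult[OF is_valuation_gauss[OF v]] val_add[OF is_valuation_gauss[OF v]]
    val_1[OF is_valuation_gauss[OF v]] pcompose_1)

lemma centered_linear: "centered v a d [:- b, 1:] = min (v (a - b)) (Fin d)"
  by (simp add: centered_def pcompose_pCons gauss_pCons[OF v] gauss_0[OF v] val_1[OF v] zero_extended_def)

lemma centered_le_val_poly: "centered v a d f \<le> v (poly f a)"
  using gauss_le_coeff_0[OF v, of d "pcompose f [:a, 1:]"] by (simp add: centered_def)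

lemma centered_mono: "d \<le> e \<Longrightarrow> centered v a d f \<le> centered v a e f"
  by (simp add: centered_def gauss_mono[OF v])

lemma centered_prescribe:
  assumes "is_divisible_group TYPE('g)" "f \<noteq> 0" "poly f a = 0"
  obtains d where "centered v a d f = Fin t"
  using gauss_prescribe[OF v assms(1), of "pcompose f [:a, 1:]"] assms(2,3)
  by (auto simp: centered_def pcompose_shift_eq_0_iff)

text \<open>\<open>poly f a\<close> is the constant term of the expansion at \<open>a\<close>. Once
  it attains the minimum it keeps doing so, because a larger \<open>d\<close> can only raise the
  other terms.\<close>

lemma centered_eq_val_poly:
  assumes "v (poly f a) \<le> centered v a d f" "d \<le> e"
  shows "centered v a e f = v (poly f a)"
  using centered_le_val_poly[of a e f] centered_mono[OF assms(2), of a f] assms(1) by order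

end

subsection \<open>Polynomials over an algebraically closed field\<close>

lemma alg_closed_poly_induct [case_names const mult]:
  fixes p :: "'a::alg_closed_field poly"
  assumes "\<And>c. P [:c:]" "\<And>b q. P q \<Longrightarrow> P ([:- b, 1:] * q)"
  shows "P p"
proof (induction "degree p" arbitrary: p rule: less_induct)
  case less
  show ?case
  proof (cases "degree p = 0")
    case True
    thus ?thesis
      using assms(1) by (auto elim: degree_eq_zeroE)
  next
    case False
    then obtain b where "poly p b = 0"
      using alg_closed_imp_poly_has_root by blast
    then obtain q where q: "p = [:- b, 1:] * q"
      by (auto simp: poly_eq_0_iff_dvd elim: dvdE)
    hence "degree p = Suc (degree q)"
      using False by (cases "q = 0") (auto simp: degree_mult_eq simp del: mult_pCons_left)
    thus ?thesis
      using less assms(2) q by simp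
  qed
qed

lemma poly_valuations_val: "\<mu> \<in> poly_valuations v \<Longrightarrow> is_valuation \<mu>"
  by (simp add: poly_valuations_def)

lemma poly_valuations_const: "\<mu> \<in> poly_valuations v \<Longrightarrow> \<mu> [:c:] = v c"
  by (simp add: poly_valuations_def)

text \<open>Both valuations agree on constants, and all other factors of \<open>f\<close> are linear
  ones at its roots.\<close>

lemma poly_valuations_le_at:
  fixes v :: "'a::alg_closed_field \<Rightarrow> 'g::linordered_ab_group_add extended"
  assumes "\<xi> \<in> poly_valuations v" "\<zeta> \<in> poly_valuations v"
    and "\<And>b. poly f b = 0 \<Longrightarrow> \<xi> [:- b, 1:] \<le> \<zeta> [:- b, 1:]"
  shows "\<xi> f \<le> \<zeta> f"
  using assms(3)
proof (induction f rule: alg_closed_poly_induct)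
  case (const c)
  show ?case
    using assms(1,2) by (simp add: poly_valuations_const)
next
  case (mult b q)
  have "\<xi> [:- b, 1:] \<le> \<zeta> [:- b, 1:]"
    by (rule mult.prems) simp
  moreover have "\<xi> q \<le> \<zeta> q"
    by (rule mult.IH, rule mult.prems) simp
  ultimately show ?case
    unfolding val_mult[OF poly_valuations_val[OF assms(1)]]
      val_mult[OF poly_valuations_val[OF assms(2)]]
    by (rule add_mono)
qed

lemma poly_valuations_leI:
  fixes v :: "'a::alg_closed_field \<Rightarrow> 'g::linordered_ab_group_add extended"
  assumes "\<xi> \<in> poly_valuations v" "\<zeta> \<in> poly_valuations v"
    and "\<And>b. \<xi> [:- b, 1:] \<le> \<zeta> [:- b, 1:]"
  shows "\<xi> \<le> \<zeta>"
  using assms poly_valuations_le_at by (blast intro: le_funI)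

lemma eq_centeredI:
  fixes v :: "'a::alg_closed_field \<Rightarrow> 'g::linordered_ab_group_add extended"
  assumes "is_valuation v" "\<xi> \<in> poly_valuations v"
    and "\<And>b. \<xi> [:- b, 1:] = min (v (a - b)) (Fin d)"
  shows "\<xi> = centered v a d"
  using assms by (intro antisym poly_valuations_leI[of _ v])
    (auto simp: centered_poly_valuations centered_linear)

lemma val_linear_finite:
  assumes "\<xi> \<in> poly_valuations v"
  obtains d where "\<xi> [:- a, 1:] = Fin d"
  using val_not_Minf[OF poly_valuations_val[OF assms], of "[:- a, 1:]"]
    val_eq_Pinf_iff[OF poly_valuations_val[OF assms], of "[:- a, 1:]"]
  by (cases "\<xi> [:- a, 1:]") auto

text \<open>\<open>x - b\<close> is the sum of \<open>x - a\<close>, which jumps, and a constant,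
  which does not. So \<open>val_add_eq_min\<close> fixes the value of \<xi> on every linear
  polynomial, and these values determine \<xi>.\<close>

lemma less_imp_centered:
  fixes v :: "'a::alg_closed_field \<Rightarrow> 'g::linordered_ab_group_add extended"
  assumes v: "is_valuation v" and "\<xi> \<in> poly_valuations v" "\<zeta> \<in> poly_valuations v"
    and "\<xi> \<le> \<zeta>" "\<xi> [:- a, 1:] < \<zeta> [:- a, 1:]"
  obtains d where "\<xi> [:- a, 1:] = Fin d" "\<xi> = centered v a d"
proof -
  obtain d where d: "\<xi> [:- a, 1:] = Fin d"
    using assms(2) by (rule val_linear_finite)
  have "\<xi> [:- b, 1:] = min (v (a - b)) (Fin d)" for b
  proof -
    have "\<xi> ([:- a, 1:] + [:a - b:]) = min (\<xi> [:- a, 1:]) (\<xi> [:a - b:])"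
      using assms by (intro val_add_eq_min[of \<xi> \<zeta>])
        (auto simp: poly_valuations_val le_funD poly_valuations_const)
    thus ?thesis
      using poly_valuations_const[OF assms(2)] d by (simp add: min.commute)
  qed
  thus thesis
    using eq_centeredI[OF v assms(2)] d that by blast
qed

text \<open>Nonzero terms of positive degree grow strictly with the value of the variable, so equal
  minima at \<open>d\<close> and \<open>e\<close> must come from the constant term.\<close>

lemma gauss_eq_val_coeff_0:
  assumes v: "is_valuation v" and "d < e" "gauss v d p = gauss v e p"
  shows "gauss v e p = v (coeff p 0)"
proof (rule ccontr)
  assume neq: "gauss v e p \<noteq> v (coeff p 0)"
  obtain c q where p: "p = pCons c q"
    by (cases p)
  have eq: "gauss v e p = Fin e + gauss v e q"
    using neq by (auto simp: p gauss_pCons[OF v] min_def)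
  have "q \<noteq> 0"
    using neq by (auto simp: p gauss_const[OF v])
  hence "Fin d + gauss v d q < Fin e + gauss v e q"
    using assms gauss_mono[OF v, of d e q] by (intro extended_add_less_le_mono)
      (auto simp: gauss_eq_Pinf_iff[OF v] gauss_not_Minf[OF v])
  moreover have "gauss v d p \<le> Fin d + gauss v d q"
    by (simp add: p gauss_pCons[OF v])
  ultimately show False
    using assms(3) eq by simp
qed

lemma centered_eq_val_poly_of_eq:
  assumes "is_valuation v" "d < e" "centered v a d f = centered v a e f"
  shows "centered v a e f = v (poly f a)"
  using gauss_eq_val_coeff_0[OF assms(1,2), of "pcompose f [:a, 1:]"] assms(3)
  by (simp add: centered_def)

lemma degree_pos_of_less:
  assumes "\<rho> \<in> poly_valuations v" "\<eta> \<in> poly_valuations v" "\<rho> f < \<eta> f"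
  shows "0 < degree f"
  using assms poly_valuations_const by (metis degree_eq_zeroE gr0I less_irrefl)

lemma obtain_min_degree:
  assumes "P (f :: 'a::zero poly)"
  obtains g where "P g" "\<And>r. degree r < degree g \<Longrightarrow> \<not> P r" "degree g \<le> degree f"
  using ex_has_least_nat[of P f degree] assms by (metis not_le)

text \<open>If \<open>a\<close> is not a center, some \<open>b\<close> has \<open>\<xi>(x - a) = v(b - a) < \<xi>(x - b)\<close>, so the factor \<open>x - a\<close>
  may be replaced by the constant \<open>b - a\<close>; \<open>u\<close> is the product of these constants.\<close>

lemma root_is_center_or_near_const:
  fixes v :: "'a::alg_closed_field \<Rightarrow> 'g::linordered_ab_group_add extended"
  assumes v: "is_valuation v" and \<xi>: "\<xi> \<in> poly_valuations v" and "f \<noteq> 0"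
    and "\<And>a d. poly f a = 0 \<Longrightarrow> \<xi> \<noteq> centered v a d"
  shows "\<exists>u. \<xi> f < \<xi> (f - [:u:])"
  using assms(3,4)
proof (induction f rule: alg_closed_poly_induct)
  case (const c)
  thus ?case
    using poly_valuations_const[OF \<xi>, of c] val_not_Minf[OF v, of c] val_eq_Pinf_iff[OF v, of c]
      val_0[OF poly_valuations_val[OF \<xi>]] by (intro exI[of _ c]) (cases "v c"; auto)
next
  case (mult a q)
  note val = poly_valuations_val[OF \<xi>]
  have q0: "q \<noteq> 0"
    using mult.prems by auto
  moreover have "\<xi> \<noteq> centered v b d" if "poly q b = 0" for b d
    using that by (intro mult.prems(2)) simp
  ultimately obtain u where u: "\<xi> q < \<xi> (q - [:u:])"
    using mult.IH by blast
  obtain d where d: "\<xi> [:- a, 1:] = Fin d"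
    using \<xi> by (rule val_linear_finite)
  have "\<xi> \<noteq> centered v a d"
    by (rule mult.prems(2)) simp
  then obtain b where b: "\<xi> [:- b, 1:] \<noteq> min (v (a - b)) (Fin d)"
    using eq_centeredI[OF v \<xi>] by blast
  have "\<xi> ([:- a, 1:] + [:a - b:]) = \<xi> [:- b, 1:]"
    by simp
  \<comment> \<open>Failure of the minimum formula at \<open>b\<close> forces
    \<open>v (a - b) = Fin d\<close> and a strictly larger value of \<open>x - b\<close>, which is
    \<open>x - a\<close> minus the constant \<open>b - a\<close>.\<close>
  hence ab: "\<xi> [:- a, 1:] < \<xi> ([:- a, 1:] - [:b - a:])"
    using b d val_add_eq_min_of_neq[OF val, of "[:- a, 1:]" "[:a - b:]"]
      val_add[OF val, of "[:- a, 1:]" "[:a - b:]"] poly_valuations_const[OF \<xi>, of "a - b"]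
    by (cases "v (a - b) = Fin d") (auto simp: min.commute)
  have "q - (q - [:u:]) = [:u:]"
    by simp
  hence "min (\<xi> q) (\<xi> (q - [:u:])) \<le> \<xi> [:u:]"
    using val_diff[OF val, of q "q - [:u:]"] by simp
  hence uq: "\<xi> q \<le> \<xi> [:u:]"
    using u by (simp add: min_def split: if_splits)
  have "[:(b - a) * u:] = [:b - a:] * [:u:]"
    by simp
  \<comment> \<open>Telescoping of a difference of products: each summand contains one small
    difference, so each has value above that of \<open>[:- a, 1:] * q\<close>.\<close>
  hence "[:- a, 1:] * q - [:(b - a) * u:]
      = [:- a, 1:] * (q - [:u:]) + ([:- a, 1:] - [:b - a:]) * [:u:]"
    by (simp only: mult_diff_mult)
  hence "min (\<xi> ([:- a, 1:] * (q - [:u:]))) (\<xi> (([:- a, 1:] - [:b - a:]) * [:u:]))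
      \<le> \<xi> ([:- a, 1:] * q - [:(b - a) * u:])"
    by (metis val_add[OF val])
  moreover have "\<xi> ([:- a, 1:] * q) < \<xi> ([:- a, 1:] * (q - [:u:]))"
    using u d unfolding val_mult[OF val] by (simp add: extended_cancel_less)
  moreover have "\<xi> ([:- a, 1:] * q) < \<xi> (([:- a, 1:] - [:b - a:]) * [:u:])"
    unfolding val_mult[OF val] using ab uq q0 val_not_Minf[OF val] val_eq_Pinf_iff[OF val]
    by (intro extended_add_less_le_mono) auto
  ultimately show ?case
    by (intro exI[of _ "(b - a) * u"]) (meson less_le_trans min_less_iff_conj)
qed

subsection \<open>Lifting polynomials along a field embedding\<close>

locale field_embedding =
  fixes \<iota> :: "'k::field \<Rightarrow> 'l::field"
  assumes one: "\<iota> 1 = 1"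
    and add: "\<iota> (a + b) = \<iota> a + \<iota> b"
    and mult: "\<iota> (a * b) = \<iota> a * \<iota> b"
begin

abbreviation lift :: "'k poly \<Rightarrow> 'l poly" where
  "lift \<equiv> map_poly \<iota>"

lemma zero: "\<iota> 0 = 0"
  using add[of 0 0] by (metis add_0 add_cancel_right_right)

lemma eq_0_iff: "\<iota> a = 0 \<longleftrightarrow> a = 0"
proof
  assume "\<iota> a = 0"
  hence "\<iota> (a * inverse a) = 0"
    by (simp add: mult)
  thus "a = 0"
    using one by (cases "a = 0") auto
qed (simp add: zero)

lemma sum: "\<iota> (sum f A) = (\<Sum>x\<in>A. \<iota> (f x))"
  by (induction A rule: infinite_finite_induct) (simp_all add: zero add)

lemma lift_add: "lift (p + q) = lift p + lift q"
  by (simp add: poly_eq_iff coeff_map_poly zero add)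

lemma lift_mult: "lift (p * q) = lift p * lift q"
  by (simp add: poly_eq_iff coeff_map_poly zero coeff_mult sum mult)

lemma lift_pCons: "lift (pCons c p) = pCons (\<iota> c) (lift p)"
  by (simp add: map_poly_pCons zero)

lemma lift_eq_0_iff: "lift p = 0 \<longleftrightarrow> p = 0"
  by (simp add: poly_eq_iff coeff_map_poly zero eq_0_iff)

lemma degree_lift: "degree (lift p) = degree p"
  by (cases "p = 0") (auto intro!: map_poly_degree_eq simp: eq_0_iff)

lemma degree_pos_of_root:
  assumes "p \<noteq> 0" "poly (lift p) a = 0"
  shows "0 < degree p"
  using assms by (cases p) (auto simp: lift_pCons lift_eq_0_iff eq_0_iff zero split: if_splits)

end

subsection \<open>Roots as centers\<close>

locale valued_closure = field_embedding \<iota>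
  for \<iota> :: "'k::field \<Rightarrow> 'l::alg_closed_field" +
  fixes v :: "'k \<Rightarrow> 'g::linordered_ab_group_add extended" and v' :: "'l \<Rightarrow> 'g extended"
  assumes algebraic: "\<exists>p. p \<noteq> 0 \<and> poly (map_poly \<iota> p) u = 0"
    and divisible: "is_divisible_group TYPE('g)"
    and v: "is_valuation v" and v': "is_valuation v'" and extends: "v' (\<iota> a) = v a"
begin

lemma restrict_poly_valuations:
  assumes "\<xi> \<in> poly_valuations v'"
  shows "(\<lambda>f. \<xi> (lift f)) \<in> poly_valuations v"
proof -
  note val = poly_valuations_val[OF assms]
  show ?thesis
    using val_not_Minf[OF val] val_eq_Pinf_iff[OF val] val_1[OF val] val_mult[OF val] val_add[OF val]
    by (auto simp: poly_valuations_def is_valuation_def lift_add lift_mult lift_eq_0_iff lift_pCons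
      poly_valuations_const[OF assms] extends one)
qed

text \<open>In Horner form each step adds a constant to a multiple of \<phi>. Nonzero multiples of
  \<phi> jump from \<rho> to \<eta> and constants do not, so \<open>val_add_eq_min\<close> excludes
  cancellation.\<close>

lemma val_pcompose_eq_gauss:
  assumes "\<rho> \<in> poly_valuations v" "\<eta> \<in> poly_valuations v" "\<rho> \<le> \<eta>"
    and "\<rho> \<phi> = Fin d" "\<rho> \<phi> < \<eta> \<phi>"
  shows "\<rho> (pcompose P \<phi>) = gauss v d P"
proof (induction P)
  case 0
  show ?case
    by (simp add: val_0 poly_valuations_val[OF assms(1)] gauss_0[OF v])
next
  case (pCons c P)
  have "\<rho> (\<phi> * pcompose P \<phi> + [:c:]) = min (\<rho> (\<phi> * pcompose P \<phi>)) (\<rho> [:c:])"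
    using assms by (intro val_add_eq_min[of \<rho> \<eta>] val_mult_less_iff)
      (auto simp: poly_valuations_val le_funD poly_valuations_const)
  thus ?case
    using pCons assms by (simp add: pcompose_pCons add.commute gauss_pCons[OF v] min.commute
      poly_valuations_const val_mult[OF poly_valuations_val[OF assms(1)]])
qed

lemma gauss_le_val_poly:
  assumes "v' u = Fin d"
  shows "gauss v d P \<le> v' (poly (lift P) u)"
proof (induction P)
  case 0
  show ?case by (simp add: val_0[OF v'])
next
  case (pCons c P)
  have "gauss v d (pCons c P) \<le> min (v' (\<iota> c)) (v' (u * poly (lift P) u))"
    using pCons by (simp add: gauss_pCons[OF v] extends val_mult[OF v'] assms min.coboundedI2 add_left_mono)
  also have "\<dots> \<le> v' (\<iota> c + u * poly (lift P) u)"
    by (rule val_add[OF v'])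
  finally show ?case
    by (simp add: lift_pCons)
qed

text \<open>\<open>lift \<phi>\<close> and \<open>u\<close> have the same value and a difference of
  larger value. Horner's scheme carries this closeness over to \<open>P\<close> evaluated at \<phi>
  and at \<open>u\<close>, measured against the Gauss value of \<open>P\<close>.\<close>

lemma gauss_less_val_pcompose_diff:
  assumes "\<xi> \<in> poly_valuations v'" "\<xi> (lift \<phi>) = Fin d" "v' u = Fin d"
    and "Fin d < \<xi> (lift \<phi> - [:u:])" "P \<noteq> 0"
  shows "gauss v d P < \<xi> (lift (pcompose P \<phi>) - [:poly (lift P) u:])"
  using assms(5)
proof (induction P)
  case (pCons c P)
  note val = poly_valuations_val[OF assms(1)]
  define y where "y = poly (lift P) u"
  have eq: "lift (pcompose (pCons c P) \<phi>) - [:poly (lift (pCons c P)) u:]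
      = lift \<phi> * (lift (pcompose P \<phi>) - [:y:]) + (lift \<phi> - [:u:]) * [:y:]"
  proof -
    have "lift (pcompose (pCons c P) \<phi>) = [:\<iota> c:] + lift \<phi> * lift (pcompose P \<phi>)"
      by (simp add: pcompose_pCons lift_add lift_mult lift_pCons)
    moreover have "[:poly (lift (pCons c P)) u:] = [:\<iota> c:] + [:u:] * [:y:]"
      by (simp add: lift_pCons y_def)
    ultimately show ?thesis
      by (simp only: add_diff_cancel_left mult_diff_mult)
  qed
  show ?case
  proof (cases "P = 0")
    \<comment> \<open>Both evaluations are then the constant \<open>\<iota> c\<close>, so the
      difference is 0 with value \<open>Pinf\<close>, while \<open>v c\<close> is finite because
      \<open>c\<close> is nonzero.\<close>
    case True
    thus ?thesis
      using pCons.hyps val_eq_Pinf_iff[OF v, of c] val_not_Minf[OF v, of c] unfolding eq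
      by (cases "v c") (auto simp: y_def gauss_const[OF v] val_0[OF val])
  next
    case False
    have "Fin d + gauss v d P < \<xi> (lift \<phi> * (lift (pcompose P \<phi>) - [:y:]))"
      using pCons False by (simp add: val_mult[OF val] assms extended_cancel_less y_def)
    moreover have "Fin d + gauss v d P < \<xi> ((lift \<phi> - [:u:]) * [:y:])"
      unfolding val_mult[OF val]
      using assms(4) gauss_le_val_poly[OF assms(3), of P] False
      by (intro extended_add_less_le_mono)
        (auto simp: poly_valuations_const[OF assms(1)] y_def gauss_eq_Pinf_iff[OF v] gauss_not_Minf[OF v])
    moreover have "gauss v d (pCons c P) \<le> Fin d + gauss v d P"
      by (simp add: gauss_pCons[OF v])
    ultimately show ?thesis
      unfolding eq using val_add[OF val] by (meson le_less_trans less_le_trans min_less_iff_conj)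
  qed
qed simp

text \<open>If no root of \<open>\<phi>\<close> were a center of \<open>\<xi>\<close>, then \<open>\<phi>\<close> would be close to a constant \<open>u\<close>.
  As \<open>u\<close> is algebraic over \<open>K\<close>, some \<open>P(\<phi>)\<close> would then have value above its Gauss value.\<close>

lemma ex_root_center:
  assumes \<xi>: "\<xi> \<in> poly_valuations v'" and \<eta>: "\<eta> \<in> poly_valuations v"
    and le: "\<And>f. \<xi> (lift f) \<le> \<eta> f" and less: "\<xi> (lift \<phi>) < \<eta> \<phi>"
  shows "\<exists>a d. poly (lift \<phi>) a = 0 \<and> \<xi> = centered v' a d"
proof (rule ccontr)
  note val = poly_valuations_val[OF \<xi>]
  assume "\<not> ?thesis"
  hence no: "\<xi> \<noteq> centered v' a d" if "poly (lift \<phi>) a = 0" for a d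
    using that by blast
  have "\<phi> \<noteq> 0"
    using less by (auto simp: val_0[OF val])
  hence nz: "lift \<phi> \<noteq> 0"
    by (simp add: lift_eq_0_iff)
  then obtain u where u: "\<xi> (lift \<phi>) < \<xi> (lift \<phi> - [:u:])"
    using root_is_center_or_near_const[OF v' \<xi> nz no] by blast
  obtain d where d: "\<xi> (lift \<phi>) = Fin d"
    using nz val_not_Minf[OF val, of "lift \<phi>"] val_eq_Pinf_iff[OF val, of "lift \<phi>"]
    by (cases "\<xi> (lift \<phi>)") auto
  have "\<xi> (lift \<phi> - [:u:] - lift \<phi>) = \<xi> (lift \<phi>)"
    using val_add_eq_right[OF val, of "- lift \<phi>" "lift \<phi> - [:u:]"] u
    by (simp add: val_uminus[OF val])
  hence vu: "v' u = Fin d"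
    using d val_uminus[OF val, of "[:u:]"] poly_valuations_const[OF \<xi>, of u] by simp
  obtain P where P: "P \<noteq> 0" "poly (lift P) u = 0"
    using algebraic by blast
  have "\<xi> (lift (pcompose P \<phi>)) = gauss v d P"
    using val_pcompose_eq_gauss[OF restrict_poly_valuations[OF \<xi>] \<eta>, of \<phi> d P] le less d
    by (auto simp: le_fun_def)
  thus False
    using gauss_less_val_pcompose_diff[OF \<xi> d vu _ P(1)] u d P(2) by simp
qed

text \<open>Write \<open>f = q * \<phi> + r\<close>. As \<phi> vanishes at \<open>a\<close>,
  \<open>f\<close> and \<open>r\<close> agree there, so the centered value of \<open>f\<close> is at
  most that of \<open>r\<close>, hence also at most that of \<open>q * \<phi>\<close>. Both are
  bounded by \<eta>, the second by induction on \<open>q\<close>, and \<eta> of the sum is at least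
  the smaller of the two.\<close>

lemma centered_le_by_division:
  assumes \<eta>: "\<eta> \<in> poly_valuations v" and \<phi>: "\<phi> \<noteq> 0" "poly (lift \<phi>) a = 0"
    and le: "centered v' a d (lift \<phi>) \<le> \<eta> \<phi>"
    and res: "\<And>r. degree r < degree \<phi> \<Longrightarrow>
      v' (poly (lift r) a) \<le> centered v' a d (lift r) \<and> centered v' a d (lift r) \<le> \<eta> r"
  shows "centered v' a d (lift f) \<le> \<eta> f"
proof (induction "degree f" arbitrary: f rule: less_induct)
  case less
  let ?w = "\<lambda>f. centered v' a d (lift f)"
  have w: "is_valuation ?w"
    by (rule poly_valuations_val[OF restrict_poly_valuations[OF centered_poly_valuations[OF v']]])
  have deg: "0 < degree \<phi>"
    using \<phi> by (rule degree_pos_of_root)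
  define q r where "q = f div \<phi>" and "r = f mod \<phi>"
  have f: "f = q * \<phi> + r"
    by (simp add: q_def r_def)
  have r: "degree r < degree \<phi>"
    using deg degree_mod_less[OF \<phi>(1), of f] by (auto simp: r_def)
  have "?w f \<le> v' (poly (lift f) a)"
    by (rule centered_le_val_poly[OF v'])
  also have "poly (lift f) a = poly (lift r) a"
    by (simp add: f lift_add lift_mult \<phi>)
  also have "v' \<dots> \<le> ?w r"
    using res[OF r] by simp
  finally have wr: "?w f \<le> ?w r" .
  have "f - r = q * \<phi>"
    by (simp add: f)
  hence wq: "?w f \<le> ?w (q * \<phi>)"
    using val_diff[OF w, of f r] wr by simp
  have "?w q \<le> \<eta> q"
  proof (cases "q = 0")
    case True
    thus ?thesis by (simp add: val_0[OF poly_valuations_val[OF \<eta>]])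
  next
    case False
    hence "degree f = degree q + degree \<phi>"
      using r \<phi> by (simp add: f degree_add_eq_left degree_mult_eq)
    thus ?thesis using less deg by simp
  qed
  hence "?w f \<le> \<eta> (q * \<phi>)"
    using wq le add_mono[of "?w q" "\<eta> q" "?w \<phi>" "\<eta> \<phi>"]
    by (simp add: val_mult[OF w] val_mult[OF poly_valuations_val[OF \<eta>]])
  moreover have "?w f \<le> \<eta> r"
    using wr res[OF r] order_trans by blast
  ultimately show ?case
    using val_add[OF poly_valuations_val[OF \<eta>], of "q * \<phi>" r] f by (metis min.boundedI order_trans)
qed

subsection \<open>Extensions above a given one\<close>

lemma ex_greater_extension:
  assumes \<xi>: "\<xi> \<in> poly_valuations v'" and \<eta>: "\<eta> \<in> poly_valuations v"
    and le: "\<And>f. \<xi> (lift f) \<le> \<eta> f" and neq: "\<xi> (lift f) \<noteq> \<eta> f"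
  shows "\<exists>\<zeta> \<in> poly_valuations v'. \<xi> < \<zeta> \<and> (\<forall>f. \<zeta> (lift f) \<le> \<eta> f)"
proof -
  let ?\<rho> = "\<lambda>f. \<xi> (lift f)"
  have \<rho>: "?\<rho> \<in> poly_valuations v"
    using \<xi> by (rule restrict_poly_valuations)
  note val\<rho> = poly_valuations_val[OF \<rho>] and val\<eta> = poly_valuations_val[OF \<eta>]
  have "?\<rho> f < \<eta> f"
    using le[of f] neq by simp
  then obtain \<phi> where \<phi>: "?\<rho> \<phi> < \<eta> \<phi>"
    and min\<phi>: "\<And>r. degree r < degree \<phi> \<Longrightarrow> \<not> ?\<rho> r < \<eta> r"
    using obtain_min_degree[of "\<lambda>r. ?\<rho> r < \<eta> r" f] by blast
  have eq: "?\<rho> r = \<eta> r" if "degree r < degree \<phi>" for r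
    using min\<phi>[OF that] le[of r] by simp
  have \<phi>0: "\<phi> \<noteq> 0"
    using \<phi> val_0[OF poly_valuations_val[OF \<xi>]] by auto
  obtain a g where a: "poly (lift \<phi>) a = 0" and g: "\<xi> = centered v' a g"
    using ex_root_center[OF \<xi> \<eta> le \<phi>] by blast
  \<comment> \<open>Below the degree of \<phi> the constant term at \<open>a\<close> attains the
    minimum. Otherwise divide \<phi> by a counterexample \<psi> of least degree: \<phi> vanishing at
    \<open>a\<close> makes the value of \<open>s\<close> exceed that of \<open>q * \<psi>\<close>.
    Since neither \<open>q\<close>, \<psi> nor \<open>s\<close> jumps, \<phi> would not jump
    either.\<close>
  have small: "v' (poly (lift r) a) \<le> ?\<rho> r" if "degree r < degree \<phi>" for r
  proof (rule ccontr)
    assume "\<not> ?thesis"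
    hence "?\<rho> r < v' (poly (lift r) a)" by simp
    then obtain \<psi> where \<psi>: "?\<rho> \<psi> < v' (poly (lift \<psi>) a)"
      and min\<psi>: "\<And>s. degree s < degree \<psi> \<Longrightarrow> \<not> ?\<rho> s < v' (poly (lift s) a)"
      and "degree \<psi> \<le> degree r"
      using obtain_min_degree[of "\<lambda>r. ?\<rho> r < v' (poly (lift r) a)" r] by blast
    hence deg: "degree \<psi> < degree \<phi>"
      using that by simp
    have pos: "0 < degree \<psi>"
    proof (rule ccontr)
      assume "\<not> ?thesis"
      then obtain c where "\<psi> = [:c:]"
        by (auto elim: degree_eq_zeroE)
      thus False
        using \<psi> by (simp add: lift_pCons poly_valuations_const[OF \<xi>])
    qed
    hence \<psi>0: "\<psi> \<noteq> 0"
      by auto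
    define q s where "q = \<phi> div \<psi>" and "s = \<phi> mod \<psi>"
    have qs: "\<phi> = q * \<psi> + s"
      by (simp add: q_def s_def)
    have s: "degree s < degree \<psi>"
      using pos degree_mod_less[OF \<psi>0, of \<phi>] by (auto simp: s_def)
    have q0: "q \<noteq> 0"
      using qs s deg by auto
    have "degree \<phi> = degree q + degree \<psi>"
      using s \<psi>0 q0 by (simp add: qs degree_add_eq_left degree_mult_eq)
    hence degq: "degree q < degree \<phi>"
      using pos by simp
    have "poly (lift s) a = - (poly (lift q) a * poly (lift \<psi>) a)"
      using a by (simp add: qs lift_add lift_mult add_eq_0_iff)
    hence "v' (poly (lift s) a) = v' (poly (lift \<psi>) a) + v' (poly (lift q) a)"
      by (simp add: val_uminus[OF v'] val_mult[OF v'] add.commute)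
    also have "?\<rho> \<psi> + ?\<rho> q < \<dots>"
      using \<psi> centered_le_val_poly[OF v', of a g "lift q"] q0 val_not_Minf[OF val\<rho>, of q]
        val_eq_Pinf_iff[OF val\<rho>, of q]
      by (intro extended_add_less_le_mono) (auto simp: g)
    also have "v' (poly (lift s) a) \<le> ?\<rho> s"
      using min\<psi>[OF s] by simp
    finally have less: "?\<rho> (q * \<psi>) < ?\<rho> s"
      using val_mult[OF val\<rho>, of q \<psi>] by (simp add: add.commute)
    have eq1: "?\<rho> (q * \<psi>) = \<eta> (q * \<psi>)"
      using val_mult[OF val\<rho>, of q \<psi>] val_mult[OF val\<eta>, of q \<psi>] eq[OF degq] eq[OF deg] by simp
    have "?\<rho> s = \<eta> s"
      using s deg by (intro eq) simp
    hence "\<eta> (q * \<psi> + s) = \<eta> (q * \<psi>)"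
      using less eq1 by (intro val_add_eq_left[OF val\<eta>]) simp
    moreover have "?\<rho> (q * \<psi> + s) = ?\<rho> (q * \<psi>)"
      by (rule val_add_eq_left[OF val\<rho> less])
    ultimately show False
      using \<phi> eq1 by (simp flip: qs)
  qed
  obtain t where t: "\<eta> \<phi> = Fin t"
    using \<phi>0 val_not_Minf[OF val\<eta>, of \<phi>] val_eq_Pinf_iff[OF val\<eta>, of \<phi>] by (cases "\<eta> \<phi>") auto
  obtain d where d: "centered v' a d (lift \<phi>) = Fin t"
    using centered_prescribe[OF v' divisible, of "lift \<phi>"] a \<phi>0 lift_eq_0_iff by metis
  have gd: "g \<le> d"
  proof (rule ccontr)
    assume "\<not> g \<le> d"
    hence "centered v' a d (lift \<phi>) \<le> ?\<rho> \<phi>"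
      unfolding g by (intro centered_mono[OF v']) simp
    thus False using \<phi> d t by simp
  qed
  \<comment> \<open>By \<open>small\<close>, raising \<open>g\<close> to \<open>d\<close> leaves the
    values in degree below that of \<phi> unchanged, and there they equal \<eta>.\<close>
  have "centered v' a d (lift f) \<le> \<eta> f" for f
  proof (rule centered_le_by_division[OF \<eta> \<phi>0 a])
    fix r :: "'k poly" assume r: "degree r < degree \<phi>"
    hence "centered v' a d (lift r) = v' (poly (lift r) a)"
      using small g gd by (intro centered_eq_val_poly[OF v']) auto
    thus "v' (poly (lift r) a) \<le> centered v' a d (lift r) \<and> centered v' a d (lift r) \<le> \<eta> r"
      using small[OF r] eq[OF r] by simp
  qed (simp add: d t)
  moreover have "\<xi> \<le> centered v' a d"
    unfolding g by (intro le_funI centered_mono[OF v'] gd)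
  moreover have "\<xi> \<noteq> centered v' a d"
    using \<phi> d t by auto
  ultimately show ?thesis
    using centered_poly_valuations[OF v'] by (auto simp: order_less_le)
qed

end

text \<open>Along a chain without maximum at some linear polynomial \<open>x - a\<close> all members are centered
  at \<open>a\<close>.  Among those \<open>a\<close>, one whose minimal polynomial over \<open>K\<close> has the least degree
  is the center of an upper bound.\<close>

definition stable_at :: "('a \<Rightarrow> 'b::order) set \<Rightarrow> 'a \<Rightarrow> bool" where
  "stable_at C f \<longleftrightarrow> (\<exists>\<xi>\<in>C. \<forall>\<zeta>\<in>C. \<zeta> f \<le> \<xi> f)"

text \<open>Of two chain members that attain the maximum on the two factors, the larger one attains
  both, hence also the maximum on the product.\<close>

lemma stable_at_poly:
  fixes v :: "'a::alg_closed_field \<Rightarrow> 'g::linordered_ab_group_add extended"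
  assumes C: "C \<subseteq> poly_valuations v" "C \<noteq> {}" "\<And>\<xi> \<zeta>. \<xi> \<in> C \<Longrightarrow> \<zeta> \<in> C \<Longrightarrow> \<xi> \<le> \<zeta> \<or> \<zeta> \<le> \<xi>"
    and "\<And>b. poly f b = 0 \<Longrightarrow> stable_at C [:- b, 1:]"
  shows "stable_at C f"
  using assms(4)
proof (induction f rule: alg_closed_poly_induct)
  case (const c)
  have "\<zeta> [:c:] = v c" if "\<zeta> \<in> C" for \<zeta>
    using that C(1) by (blast intro: poly_valuations_const)
  thus ?case
    using C(2) unfolding stable_at_def by (metis all_not_in_conv order_refl)
next
  case (mult b q)
  obtain \<xi> where \<xi>: "\<xi> \<in> C" "\<And>\<zeta>. \<zeta> \<in> C \<Longrightarrow> \<zeta> [:- b, 1:] \<le> \<xi> [:- b, 1:]"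
    using mult.prems[of b] by (auto simp: stable_at_def)
  have "stable_at C q"
    by (rule mult.IH, rule mult.prems) simp
  then obtain \<xi>' where \<xi>': "\<xi>' \<in> C" "\<And>\<zeta>. \<zeta> \<in> C \<Longrightarrow> \<zeta> q \<le> \<xi>' q"
    by (auto simp: stable_at_def)
  obtain \<theta> where \<theta>: "\<theta> \<in> C" "\<xi> \<le> \<theta>" "\<xi>' \<le> \<theta>"
    using C(3)[OF \<xi>(1) \<xi>'(1)] \<xi>(1) \<xi>'(1) by blast
  show ?case
    unfolding stable_at_def
  proof (intro bexI[OF _ \<theta>(1)] ballI)
    fix \<zeta> assume \<zeta>: "\<zeta> \<in> C"
    have "\<zeta> [:- b, 1:] + \<zeta> q \<le> \<theta> [:- b, 1:] + \<theta> q"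
      using \<xi>(2)[OF \<zeta>] \<xi>'(2)[OF \<zeta>] \<theta>(2,3) by (intro add_mono) (meson le_funD order_trans)+
    moreover have "\<zeta> ([:- b, 1:] * q) = \<zeta> [:- b, 1:] + \<zeta> q" "\<theta> ([:- b, 1:] * q) = \<theta> [:- b, 1:] + \<theta> q"
      using \<zeta> \<theta>(1) C(1) by (auto simp del: mult_pCons_left intro: val_mult poly_valuations_val)
    ultimately show "\<zeta> ([:- b, 1:] * q) \<le> \<theta> ([:- b, 1:] * q)"
      by (simp only:)
  qed
qed

text \<open>The bound is the pointwise maximum \<open>S\<close>. Each valuation axiom involves at
  most three polynomials, and a single chain member agrees with \<open>S\<close> on all of
  them.\<close>

lemma stable_chain_sup:
  fixes v :: "'a::field \<Rightarrow> 'g::linordered_ab_group_add extended"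
  assumes C: "C \<subseteq> poly_valuations v" "\<And>\<xi> \<zeta>. \<xi> \<in> C \<Longrightarrow> \<zeta> \<in> C \<Longrightarrow> \<xi> \<le> \<zeta> \<or> \<zeta> \<le> \<xi>"
    and stable: "\<And>f. stable_at C f"
  shows "\<exists>\<zeta> \<in> poly_valuations v. (\<forall>\<xi>\<in>C. \<xi> \<le> \<zeta>) \<and> (\<forall>f. \<exists>\<xi>\<in>C. \<zeta> f = \<xi> f)"
proof -
  obtain X where X: "\<And>f. X f \<in> C" "\<And>f \<zeta>. \<zeta> \<in> C \<Longrightarrow> \<zeta> f \<le> X f f"
    using stable unfolding stable_at_def by metis
  define S where "S f = X f f" for f
  have S_eq: "\<theta> f = S f" if "\<theta> \<in> C" "X f \<le> \<theta>" for \<theta> f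
    using X(2)[OF that(1), of f] le_funD[OF that(2), of f] by (simp add: S_def)
  have common: "\<exists>\<theta>\<in>C. \<theta> f = S f \<and> \<theta> g = S g \<and> \<theta> h = S h" for f g h
  proof -
    obtain \<theta> where "\<theta> \<in> C" "X f \<le> \<theta>" "X g \<le> \<theta>"
      using C(2)[OF X(1) X(1), of f g] X(1) by blast
    then obtain \<theta>' where "\<theta>' \<in> C" "X f \<le> \<theta>'" "X g \<le> \<theta>'" "X h \<le> \<theta>'"
      using C(2)[OF _ X(1), of \<theta> h] X(1) order_trans by blast
    thus ?thesis
      using S_eq by blast
  qed
  have val: "is_valuation \<theta>" if "\<theta> \<in> C" for \<theta>
    using that C(1) by (auto intro: poly_valuations_val)
  have "is_valuation S"
    unfolding is_valuation_def
  proof (intro conjI allI)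
    fix f g
    show "S f \<noteq> Minf" "S f = Pinf \<longleftrightarrow> f = 0" "S 1 = 0"
      using val_not_Minf[OF val[OF X(1)]] val_eq_Pinf_iff[OF val[OF X(1)]] val_1[OF val[OF X(1)]]
      by (simp_all add: S_def)
    show "S (f * g) = S f + S g"
      using common[of f g "f * g"] val_mult[OF val] by metis
    show "min (S f) (S g) \<le> S (f + g)"
      using common[of f g "f + g"] val_add[OF val] by metis
  qed
  moreover have "S [:c:] = v c" for c
    using poly_valuations_const[of "X [:c:]" v c] X(1) C(1) by (auto simp: S_def)
  ultimately have S: "S \<in> poly_valuations v"
    unfolding poly_valuations_def by blast
  have "\<forall>\<xi>\<in>C. \<xi> \<le> S"
    using X(2) by (simp add: S_def le_fun_def)
  moreover have "\<exists>\<xi>\<in>C. S f = \<xi> f" for f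
    using X(1) by (auto simp: S_def)
  ultimately show ?thesis
    using S by blast
qed

section \<open>Upper bounds of chains, and a maximal extension by Zorn's lemma\<close>

context valued_closure
begin

lemma chain_upper_bound:
  assumes C: "C \<subseteq> poly_valuations v'" "C \<noteq> {}" "\<And>\<xi> \<zeta>. \<xi> \<in> C \<Longrightarrow> \<zeta> \<in> C \<Longrightarrow> \<xi> \<le> \<zeta> \<or> \<zeta> \<le> \<xi>"
    and \<eta>: "\<eta> \<in> poly_valuations v"
    and le: "\<And>\<xi> f. \<xi> \<in> C \<Longrightarrow> \<xi> (lift f) \<le> \<eta> f"
  shows "\<exists>\<zeta> \<in> poly_valuations v'. (\<forall>\<xi>\<in>C. \<xi> \<le> \<zeta>) \<and> (\<forall>f. \<zeta> (lift f) \<le> \<eta> f)"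
proof (cases "\<forall>f. stable_at C f")
  case True
  thus ?thesis
    using stable_chain_sup[OF C(1,3)] le by metis
next
  case False
  then obtain a0 where a0: "\<not> stable_at C [:- a0, 1:]"
    using stable_at_poly[OF C] by blast
  note val\<eta> = poly_valuations_val[OF \<eta>]
  obtain p where "p \<noteq> 0" "poly (lift p) a0 = 0"
    using algebraic by blast
  \<comment> \<open>Choosing \<phi> of least degree with \<open>P\<close> makes the chain stable at
    every linear factor of a nonzero \<open>lift r\<close> of smaller degree, hence at
    \<open>lift r\<close> itself.\<close>
  define P where "P r \<longleftrightarrow> r \<noteq> 0 \<and> (\<exists>a. poly (lift r) a = 0 \<and> \<not> stable_at C [:- a, 1:])" for r
  have "P p"
    using a0 \<open>p \<noteq> 0\<close> \<open>poly (lift p) a0 = 0\<close> unfolding P_def by blast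
  then obtain \<phi> where P: "P \<phi>" and min\<phi>: "\<And>r. degree r < degree \<phi> \<Longrightarrow> \<not> P r"
    using obtain_min_degree[of P p] by blast
  obtain a where a: "poly (lift \<phi>) a = 0" "\<not> stable_at C [:- a, 1:]"
    using P unfolding P_def by blast
  have \<phi>: "\<phi> \<noteq> 0"
    using P by (simp add: P_def)
  have larger: "\<exists>\<zeta>\<in>C. \<xi> \<le> \<zeta> \<and> \<xi> [:- a, 1:] < \<zeta> [:- a, 1:]" if \<xi>: "\<xi> \<in> C" for \<xi>
  proof -
    have "\<exists>\<zeta>\<in>C. \<not> \<zeta> [:- a, 1:] \<le> \<xi> [:- a, 1:]"
      using a(2) \<xi> unfolding stable_at_def by blast
    then obtain \<zeta> where \<zeta>: "\<zeta> \<in> C" "\<not> \<zeta> [:- a, 1:] \<le> \<xi> [:- a, 1:]"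
      by blast
    hence "\<xi> \<le> \<zeta>"
      using C(3)[OF \<xi> \<zeta>(1)] le_funD[of \<zeta> \<xi> "[:- a, 1:]"] by blast
    thus ?thesis
      using \<zeta> by auto
  qed
  have centered: "\<exists>g. \<xi> [:- a, 1:] = Fin g \<and> \<xi> = centered v' a g" if \<xi>: "\<xi> \<in> C" for \<xi>
  proof -
    obtain \<zeta> where "\<zeta> \<in> C" "\<xi> \<le> \<zeta>" "\<xi> [:- a, 1:] < \<zeta> [:- a, 1:]"
      using larger[OF \<xi>] by blast
    thus ?thesis
      using less_imp_centered[OF v', of \<xi> \<zeta> a] \<xi> C(1) by blast
  qed
  obtain t where t: "\<eta> \<phi> = Fin t"
    using \<phi> val_not_Minf[OF val\<eta>, of \<phi>] val_eq_Pinf_iff[OF val\<eta>, of \<phi>] by (cases "\<eta> \<phi>") auto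
  obtain d where d: "centered v' a d (lift \<phi>) = Fin t"
    using centered_prescribe[OF v' divisible, of "lift \<phi>"] a \<phi> lift_eq_0_iff by metis
  \<comment> \<open>If \<open>g\<close> reached \<open>d\<close>, the member would already have
    value at least \<open>t\<close> at \<phi>. A larger member jumps at \<open>x - a\<close>, hence
    at its multiple \<open>lift \<phi>\<close>, and would exceed \<eta> there.\<close>
  have less_d: "g < d" if g: "centered v' a g \<in> C" for g
  proof (rule ccontr)
    let ?\<xi> = "centered v' a g"
    assume "\<not> g < d"
    hence "Fin t \<le> ?\<xi> (lift \<phi>)"
      using centered_mono[OF v', of d g a "lift \<phi>"] d by simp
    moreover obtain \<zeta> where \<zeta>: "\<zeta> \<in> C" "?\<xi> \<le> \<zeta>" "?\<xi> [:- a, 1:] < \<zeta> [:- a, 1:]"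
      using larger[OF g] by blast
    obtain h where h: "lift \<phi> = [:- a, 1:] * h"
      using a(1) by (auto simp: poly_eq_0_iff_dvd elim: dvdE)
    have "h \<noteq> 0"
      using \<phi> h lift_eq_0_iff[of \<phi>] by auto
    have "?\<xi> ([:- a, 1:] * h) < \<zeta> ([:- a, 1:] * h)"
      using \<zeta>(3) \<open>h \<noteq> 0\<close>
      by (rule val_mult_strict_mono[OF poly_valuations_val[OF subsetD[OF C(1) g]]
        poly_valuations_val[OF subsetD[OF C(1) \<zeta>(1)]] le_funD[OF \<zeta>(2)]])
    hence "?\<xi> (lift \<phi>) < \<zeta> (lift \<phi>)"
      by (simp only: h)
    ultimately show False
      using le[OF \<zeta>(1), of \<phi>] t by simp
  qed
  have "centered v' a d (lift f) \<le> \<eta> f" for f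
  proof (rule centered_le_by_division[OF \<eta> _ a(1)])
    fix r :: "'k poly" assume r: "degree r < degree \<phi>"
    show "v' (poly (lift r) a) \<le> centered v' a d (lift r) \<and> centered v' a d (lift r) \<le> \<eta> r"
    proof (cases "r = 0")
      case True
      thus ?thesis
        by (simp add: val_0[OF val\<eta>] val_0[OF poly_valuations_val[OF centered_poly_valuations[OF v']]])
    next
      case False
      have roots: "stable_at C [:- b, 1:]" if "poly (lift r) b = 0" for b
        using min\<phi>[OF r] False that unfolding P_def by blast
      have "stable_at C (lift r)"
        by (rule stable_at_poly[OF C roots])
      then obtain \<xi> where \<xi>: "\<xi> \<in> C" "\<And>\<zeta>. \<zeta> \<in> C \<Longrightarrow> \<zeta> (lift r) \<le> \<xi> (lift r)"
        unfolding stable_at_def by blast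
      obtain \<zeta> where \<zeta>: "\<zeta> \<in> C" "\<xi> \<le> \<zeta>" "\<xi> [:- a, 1:] < \<zeta> [:- a, 1:]"
        using larger[OF \<xi>(1)] by blast
      obtain g where g: "\<xi> [:- a, 1:] = Fin g" "\<xi> = centered v' a g"
        using centered[OF \<xi>(1)] by blast
      obtain g' where g': "\<zeta> [:- a, 1:] = Fin g'" "\<zeta> = centered v' a g'"
        using centered[OF \<zeta>(1)] by blast
      \<comment> \<open>Two members with different parameters at \<open>a\<close> agree on
        \<open>lift r\<close>, so its constant term at \<open>a\<close> attains the minimum and the
        value stays the same up to \<open>d\<close>.\<close>
      have "\<xi> (lift r) = \<zeta> (lift r)"
        using \<xi>(2)[OF \<zeta>(1)] le_funD[OF \<zeta>(2), of "lift r"] by (rule antisym[rotated])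
      moreover have "g < g'"
        using \<zeta>(3) unfolding g(1) g'(1) by simp
      ultimately have eq: "\<zeta> (lift r) = v' (poly (lift r) a)"
        using centered_eq_val_poly_of_eq[OF v', of g g' a "lift r"] g(2) g'(2) by metis
      have "g' < d"
        using less_d[of g'] \<zeta>(1) g'(2) by metis
      hence "centered v' a d (lift r) = v' (poly (lift r) a)"
        using centered_eq_val_poly[OF v', of "lift r" a g' d] g'(2) eq by (metis order_refl less_imp_le)
      thus ?thesis
        using le[OF \<zeta>(1), of r] eq by simp
    qed
  qed (simp_all add: \<phi> d t)
  moreover have "\<xi> \<le> centered v' a d" if \<xi>: "\<xi> \<in> C" for \<xi>
  proof -
    obtain g where "\<xi> = centered v' a g"
      using centered[OF \<xi>] by blast
    thus ?thesis
      using less_d[of g] \<xi> centered_mono[OF v', of g d a] by (simp add: le_fun_def)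
  qed
  ultimately show ?thesis
    using centered_poly_valuations[OF v'] by blast
qed

lemma ex_extension_above:
  assumes \<mu>': "\<mu>' \<in> poly_valuations v'" and \<eta>: "\<eta> \<in> poly_valuations v"
    and le: "\<And>f. \<mu>' (lift f) \<le> \<eta> f"
  shows "\<exists>\<eta>' \<in> poly_valuations v'. \<mu>' \<le> \<eta>' \<and> (\<forall>f. \<eta>' (lift f) = \<eta> f)"
proof -
  define Z where "Z = {\<xi> \<in> poly_valuations v'. \<mu>' \<le> \<xi> \<and> (\<forall>f. \<xi> (lift f) \<le> \<eta> f)}"
  have "\<exists>\<xi>\<in>Z. \<forall>\<zeta>\<in>Z. \<xi> \<le> \<zeta> \<longrightarrow> \<zeta> = \<xi>"
  proof (rule predicate_Zorn)
    show "partial_order_on Z (relation_of (\<le>) Z)"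
      by (rule partial_order_on_relation_ofI) auto
  next
    fix C assume "C \<in> Chains (relation_of (\<le>) Z)"
    hence C: "C \<subseteq> Z" "\<And>\<xi> \<zeta>. \<xi> \<in> C \<Longrightarrow> \<zeta> \<in> C \<Longrightarrow> \<xi> \<le> \<zeta> \<or> \<zeta> \<le> \<xi>"
      by (auto simp: Chains_def relation_of_def)
    show "\<exists>\<zeta>\<in>Z. \<forall>\<xi>\<in>C. \<xi> \<le> \<zeta>"
    proof (cases "C = {}")
      case True
      thus ?thesis
        using \<mu>' le by (auto simp: Z_def)
    next
      case False
      then obtain \<xi> where \<xi>: "\<xi> \<in> C"
        by blast
      obtain \<zeta> where \<zeta>: "\<zeta> \<in> poly_valuations v'" "\<forall>\<xi>\<in>C. \<xi> \<le> \<zeta>" "\<forall>f. \<zeta> (lift f) \<le> \<eta> f"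
        using chain_upper_bound[OF _ False C(2) \<eta>] C(1) by (auto simp: Z_def subset_iff)
      moreover have "\<mu>' \<le> \<zeta>"
        using \<xi> C(1) \<zeta>(2) order_trans by (force simp: Z_def)
      ultimately show ?thesis
        by (auto simp: Z_def)
    qed
  qed
  then obtain \<xi> where \<xi>: "\<xi> \<in> Z" and max: "\<And>\<zeta>. \<zeta> \<in> Z \<Longrightarrow> \<xi> \<le> \<zeta> \<Longrightarrow> \<zeta> = \<xi>"
    by blast
  have "\<xi> (lift f) = \<eta> f" for f
  proof (rule ccontr)
    assume "\<xi> (lift f) \<noteq> \<eta> f"
    then obtain \<zeta> where "\<zeta> \<in> poly_valuations v'" "\<xi> < \<zeta>" "\<forall>f. \<zeta> (lift f) \<le> \<eta> f"
      using ex_greater_extension[OF _ \<eta>, of \<xi> f] \<xi> unfolding Z_def by blast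
    moreover from this have "\<zeta> \<in> Z"
      using \<xi> less_imp_le order_trans unfolding Z_def by blast
    ultimately show False
      using max[of \<zeta>] by (simp add: order_less_le)
  qed
  thus ?thesis
    using \<xi> by (auto simp: Z_def)
qed

end

subsection \<open>Extensions below a given one\<close>

text \<open>The set of valuations below \<open>\<mu>\<close> is totally ordered, so one of them is determined by its
  value on a single polynomial where it differs from \<open>\<mu>\<close>.\<close>

lemma poly_valuations_eqI:
  assumes \<nu>: "\<nu> \<in> poly_valuations v" and \<rho>: "\<rho> \<in> poly_valuations v" and \<mu>: "\<mu> \<in> poly_valuations v"
    and le: "\<nu> \<le> \<mu>" "\<rho> \<le> \<mu>" and eq: "\<nu> \<phi> = \<rho> \<phi>" and less: "\<nu> \<phi> < \<mu> \<phi>"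
    and min\<phi>: "\<And>r. degree r < degree \<phi> \<Longrightarrow> \<nu> r = \<mu> r"
  shows "\<nu> = \<rho>"
proof -
  note val\<nu> = poly_valuations_val[OF \<nu>] and val\<rho> = poly_valuations_val[OF \<rho>]
    and val\<mu> = poly_valuations_val[OF \<mu>]
    and le\<nu> = le_funD[OF le(1)] and le\<rho> = le_funD[OF le(2)]
  \<comment> \<open>Otherwise divide \<phi> by a jumping \<psi> of least degree. Depending on which
    of \<open>\<psi> * q\<close> and \<open>s\<close> determines \<open>\<rho> \<phi>\<close>,
    either \<rho> falls below \<nu> at \<phi>, or \<mu> takes the value of \<rho> there; both
    contradict the equality and the jump at \<phi>.\<close>
  have \<rho>min: "\<rho> r = \<mu> r" if "degree r < degree \<phi>" for r
  proof (rule ccontr)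
    assume "\<rho> r \<noteq> \<mu> r"
    hence "\<rho> r < \<mu> r"
      using le_funD[OF le(2), of r] by simp
    then obtain \<psi> where \<psi>: "\<rho> \<psi> < \<mu> \<psi>" and min\<psi>: "\<And>s. degree s < degree \<psi> \<Longrightarrow> \<not> \<rho> s < \<mu> s"
      and "degree \<psi> \<le> degree r"
      using obtain_min_degree[of "\<lambda>r. \<rho> r < \<mu> r" r] by blast
    hence deg: "degree \<psi> < degree \<phi>"
      using that by simp
    have pos: "0 < degree \<psi>"
      using \<rho> \<mu> \<psi> by (rule degree_pos_of_less)
    hence \<psi>0: "\<psi> \<noteq> 0"
      by auto
    define q s where "q = \<phi> div \<psi>" and "s = \<phi> mod \<psi>"
    have qs: "\<phi> = \<psi> * q + s"
      by (simp add: q_def s_def)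
    have s: "degree s < degree \<psi>"
      using pos degree_mod_less[OF \<psi>0, of \<phi>] by (auto simp: s_def)
    have q0: "q \<noteq> 0"
      using qs s deg by auto
    have "degree \<phi> = degree \<psi> + degree q"
      using s \<psi>0 q0 by (simp add: qs degree_add_eq_left degree_mult_eq)
    hence \<nu>q: "\<nu> q = \<mu> q"
      using pos by (intro min\<phi>) simp
    have \<rho>s: "\<rho> s = \<mu> s"
      using min\<psi>[OF s] le_funD[OF le(2), of s] by simp
    have \<nu>s: "\<nu> s = \<mu> s"
      using s deg by (intro min\<phi>) simp
    have less\<psi>: "\<rho> (\<psi> * q) < \<mu> (\<psi> * q)"
      by (rule val_mult_strict_mono[OF val\<rho> val\<mu> le\<rho> \<psi> q0])
    have \<nu>\<mu>: "\<nu> (\<psi> * q) = \<mu> (\<psi> * q)"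
      using min\<phi>[OF deg] \<nu>q by (simp add: val_mult[OF val\<nu>] val_mult[OF val\<mu>])
    have \<rho>\<phi>: "\<rho> \<phi> = min (\<rho> (\<psi> * q)) (\<rho> s)"
      unfolding qs
      by (rule val_add_eq_min[OF val\<rho> val\<mu> le\<rho> val_mult_less_iff[OF val\<rho> val\<mu> le\<rho> \<psi>] \<rho>s])
    show False
    proof (cases "\<rho> (\<psi> * q) < \<rho> s")
      case True
      hence "\<rho> \<phi> < min (\<nu> (\<psi> * q)) (\<nu> s)"
        using \<rho>\<phi> less\<psi> \<nu>\<mu> \<nu>s \<rho>s by simp
      hence "\<rho> \<phi> < \<nu> \<phi>"
        using val_add[OF val\<nu>, of "\<psi> * q" s] unfolding qs by (rule less_le_trans)
      thus False
        using eq by simp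
    next
      case False
      hence "\<mu> (s + \<psi> * q) = \<mu> s"
        using less\<psi> \<rho>s by (intro val_add_eq_left[OF val\<mu>]) auto
      thus False
        using False \<rho>\<phi> \<rho>s eq less by (simp add: qs add.commute)
    qed
  qed
  have pos: "0 < degree \<phi>"
    using \<nu> \<mu> less by (rule degree_pos_of_less)
  hence \<phi>0: "\<phi> \<noteq> 0"
    by auto
  have jump: "\<nu> \<phi> < \<mu> \<phi>" "\<rho> \<phi> < \<mu> \<phi>"
    using less eq by simp_all
  \<comment> \<open>Under both valuations the value of \<open>\<phi> * q + r\<close> is the minimum
    over the two summands, where \<open>q\<close> is covered by induction and \<open>r\<close> by
    agreement with \<mu>.\<close>
  have "\<nu> f = \<rho> f" for f
  proof (induction "degree f" arbitrary: f rule: less_induct)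
    case (less f)
    define q r where "q = f div \<phi>" and "r = f mod \<phi>"
    have f: "f = \<phi> * q + r"
      by (simp add: q_def r_def)
    have r: "degree r < degree \<phi>"
      using pos degree_mod_less[OF \<phi>0, of f] by (auto simp: r_def)
    have "\<nu> q = \<rho> q"
    proof (cases "q = 0")
      case True
      thus ?thesis by (simp add: val_0 val\<nu> val\<rho>)
    next
      case False
      hence "degree f = degree \<phi> + degree q"
        using r \<phi>0 by (simp add: f degree_add_eq_left degree_mult_eq)
      thus ?thesis using less pos by simp
    qed
    hence "\<nu> (\<phi> * q) = \<rho> (\<phi> * q)"
      using eq by (simp add: val_mult[OF val\<nu>] val_mult[OF val\<rho>])
    moreover have "\<nu> (\<phi> * q + r) = min (\<nu> (\<phi> * q)) (\<nu> r)"
      by (rule val_add_eq_min[OF val\<nu> val\<mu> le\<nu> val_mult_less_iff[OF val\<nu> val\<mu> le\<nu> jump(1)] min\<phi>[OF r]])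
    moreover have "\<rho> (\<phi> * q + r) = min (\<rho> (\<phi> * q)) (\<rho> r)"
      by (rule val_add_eq_min[OF val\<rho> val\<mu> le\<rho> val_mult_less_iff[OF val\<rho> val\<mu> le\<rho> jump(2)] \<rho>min[OF r]])
    ultimately show ?case
      using \<rho>min[OF r] min\<phi>[OF r] f by simp
  qed
  thus ?thesis by blast
qed

context valued_closure
begin

lemma ex_extension_below:
  assumes \<nu>: "\<nu> \<in> poly_valuations v" and \<mu>: "\<mu> \<in> poly_valuations v" and "\<nu> < \<mu>"
    and \<mu>': "\<mu>' \<in> poly_valuations v'" and ext: "\<And>f. \<mu>' (lift f) = \<mu> f"
  shows "\<exists>\<nu>' \<in> poly_valuations v'. \<nu>' \<le> \<mu>' \<and> (\<forall>f. \<nu>' (lift f) = \<nu> f)"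
proof -
  note val\<mu>' = poly_valuations_val[OF \<mu>']
  have le: "\<nu> \<le> \<mu>"
    using assms(3) by simp
  obtain f where "\<nu> f < \<mu> f"
    using assms(3) by (auto simp: less_fun_def le_fun_def not_le)
  then obtain \<phi> where \<phi>: "\<nu> \<phi> < \<mu> \<phi>" and min\<phi>: "\<And>r. degree r < degree \<phi> \<Longrightarrow> \<not> \<nu> r < \<mu> r"
    using obtain_min_degree[of "\<lambda>r. \<nu> r < \<mu> r" f] by blast
  have pos: "0 < degree \<phi>"
    using \<nu> \<mu> \<phi> by (rule degree_pos_of_less)
  hence \<phi>0: "lift \<phi> \<noteq> 0"
    by (auto simp: lift_eq_0_iff)
  define R where "R = {a. poly (lift \<phi>) a = 0}"
  define W where "W = (\<lambda>a. \<mu>' [:- a, 1:]) ` R"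
  have "finite W"
    unfolding W_def R_def using \<phi>0 by (intro finite_imageI poly_roots_finite)
  moreover have "W \<noteq> {}"
    using alg_closed_imp_poly_has_root[of "lift \<phi>"] pos by (auto simp: W_def R_def degree_lift)
  ultimately have "Max W \<in> W" "\<And>x. x \<in> W \<Longrightarrow> x \<le> Max W"
    by auto
  then obtain a where a: "poly (lift \<phi>) a = 0"
    and max: "\<And>b. poly (lift \<phi>) b = 0 \<Longrightarrow> \<mu>' [:- b, 1:] \<le> \<mu>' [:- a, 1:]"
    by (auto simp: W_def R_def)
  obtain m where m: "\<mu>' [:- a, 1:] = Fin m"
    using \<mu>' by (rule val_linear_finite)
  \<comment> \<open>This is where maximality of \<open>a\<close> among the roots enters: for a root
    \<open>b\<close>, \<open>x - b\<close> has value at most \<open>m\<close>, so it is also bounded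
    by \<open>v' (a - b)\<close>. The jump at \<phi> thus persists for \<omega>(a, m), which later
    gives \<open>d \<le> m\<close>.\<close>
  have "\<mu>' (lift \<phi>) \<le> centered v' a m (lift \<phi>)"
  proof (rule poly_valuations_le_at[OF \<mu>' centered_poly_valuations[OF v']])
    fix b assume "poly (lift \<phi>) b = 0"
    hence b: "\<mu>' [:- b, 1:] \<le> Fin m"
      using max m by simp
    have "[:- b, 1:] - [:- a, 1:] = [:a - b:]"
      by simp
    hence "min (\<mu>' [:- b, 1:]) (Fin m) \<le> v' (a - b)"
      using val_diff[OF val\<mu>', of "[:- b, 1:]" "[:- a, 1:]"] m poly_valuations_const[OF \<mu>'] by metis
    thus "\<mu>' [:- b, 1:] \<le> centered v' a m [:- b, 1:]"
      using b by (simp add: centered_linear[OF v'] min_def)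
  qed
  hence above: "\<nu> \<phi> < centered v' a m (lift \<phi>)"
    using \<phi> ext by simp
  have "\<phi> \<noteq> 0"
    using pos by auto
  then obtain t where t: "\<nu> \<phi> = Fin t"
    using val_not_Minf[OF poly_valuations_val[OF \<nu>], of \<phi>]
      val_eq_Pinf_iff[OF poly_valuations_val[OF \<nu>], of \<phi>] by (cases "\<nu> \<phi>") auto
  obtain d where d: "centered v' a d (lift \<phi>) = Fin t"
    using centered_prescribe[OF v' divisible \<phi>0 a] by metis
  have dm: "d \<le> m"
    using above centered_mono[OF v', of m d a "lift \<phi>"] d t by (metis leD linear)
  \<comment> \<open>For arbitrary \<open>b\<close>, write \<open>x - b\<close> as
    \<open>x - a\<close> plus a constant; its \<mu>' value is at least the minimum with
    \<open>m\<close>, and \<open>d \<le> m\<close>.\<close>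
  have below: "centered v' a d \<le> \<mu>'"
  proof (rule poly_valuations_leI[OF centered_poly_valuations[OF v'] \<mu>'])
    fix b
    have "min (Fin m) (v' (a - b)) \<le> \<mu>' ([:- a, 1:] + [:a - b:])"
      using val_add[OF val\<mu>', of "[:- a, 1:]" "[:a - b:]"] m poly_valuations_const[OF \<mu>'] by metis
    moreover have "min (Fin d) (v' (a - b)) \<le> min (Fin m) (v' (a - b))"
      using dm by (intro min.mono) auto
    ultimately have "min (Fin d) (v' (a - b)) \<le> \<mu>' ([:- a, 1:] + [:a - b:])"
      by (rule order_trans[rotated])
    thus "centered v' a d [:- b, 1:] \<le> \<mu>' [:- b, 1:]"
      by (simp add: centered_linear[OF v'] min.commute)
  qed
  have "\<nu> = (\<lambda>f. centered v' a d (lift f))"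
  proof (rule poly_valuations_eqI[OF \<nu> _ \<mu> le])
    show "(\<lambda>f. centered v' a d (lift f)) \<in> poly_valuations v"
      by (rule restrict_poly_valuations[OF centered_poly_valuations[OF v']])
    show "(\<lambda>f. centered v' a d (lift f)) \<le> \<mu>"
      using below by (simp add: le_fun_def flip: ext)
    show "\<nu> r = \<mu> r" if "degree r < degree \<phi>" for r
      using min\<phi>[OF that] le_funD[OF le, of r] by simp
  qed (use \<phi> d t in auto)
  thus ?thesis
    using below centered_poly_valuations[OF v'] by metis
qed

end

theorem theorem3p1:
  fixes \<iota> :: "'k::field \<Rightarrow> 'l::alg_closed_field"
    and v :: "'k \<Rightarrow> 'g::linordered_ab_group_add extended"
    and v' :: "'l \<Rightarrow> 'g extended"
    and \<nu> \<mu> \<eta> :: "'k poly \<Rightarrow> 'g extended"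
    and \<mu>' :: "'l poly \<Rightarrow> 'g extended"
  assumes "is_algebraic_closure \<iota>"
    and "is_divisible_group TYPE('g)"
    and "is_valuation v"
    and "is_valuation v'" and "\<forall>a. v' (\<iota> a) = v a"
    and "\<nu> \<in> poly_valuations v" and "\<mu> \<in> poly_valuations v" and "\<eta> \<in> poly_valuations v"
    and "\<nu> < \<mu>" and "\<mu> \<le> \<eta>"
    and "\<mu>' \<in> poly_valuations v'" and "extends_valuation \<iota> \<mu>' \<mu>"
  shows "\<exists>\<nu>' \<in> poly_valuations v'. \<exists>\<eta>' \<in> poly_valuations v'.
           extends_valuation \<iota> \<nu>' \<nu> \<and> extends_valuation \<iota> \<eta>' \<eta> \<and> \<nu>' < \<mu>' \<and> \<mu>' \<le> \<eta>'"
proof -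
  interpret valued_closure \<iota> v v'
    using assms(1-5) by unfold_locales (auto simp: is_algebraic_closure_def)
  have lift_eq: "\<mu>' (lift f) = \<mu> f" for f
    using assms(12) by (simp add: extends_valuation_def)
  obtain \<eta>' where \<eta>': "\<eta>' \<in> poly_valuations v'" "\<mu>' \<le> \<eta>'" "\<forall>f. \<eta>' (lift f) = \<eta> f"
    using ex_extension_above[OF assms(11,8)] assms(10) lift_eq by (auto simp: le_fun_def)
  obtain \<nu>' where \<nu>': "\<nu>' \<in> poly_valuations v'" "\<nu>' \<le> \<mu>'" "\<forall>f. \<nu>' (lift f) = \<nu> f"
    using ex_extension_below[OF assms(6,7,9,11) lift_eq] by blast
  have "\<nu>' \<noteq> \<mu>'"
  proof
    assume "\<nu>' = \<mu>'"
    hence "\<nu> = \<mu>"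
      using \<nu>'(3) lift_eq by (intro ext) simp
    thus False
      using assms(9) by simp
  qed
  thus ?thesis
    using \<eta>' \<nu>' by (auto simp: extends_valuation_def order_less_le)
qed

end
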